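(* Suppose there exists a $t$-$(v,k,1)$-design with $t\leq\frac{k}{2}+1$. Let $t_0$ be a positive integer such that $\frac{t}{2}\leq t_0\leq t-1$. Then for each of the following three sets of parameters, every $(K,M,N)$ caching system with the given $K$ and the given ratio $\frac{M}{N}$ admits an $F$-division caching scheme with rate $R$: 1) $K=F=\binom{v}{t_0}$, $\ \frac{M}{N}=1-\dfrac{\binom{v-t_0}{t-t_0}}{\binom{k-t_0}{t-t_0}\binom{v}{t_0}}$, $\ R=\dfrac{\binom{v}{t}}{\binom{k}{t}\binom{v}{t_0}}$; 2) $K=\binom{v}{t_0}$, $\ \frac{M}{N}=1-\dfrac{\binom{k}{t_0}}{\binom{v}{t_0}}$, $\ R=\dfrac{\binom{v}{t_0}\binom{k}{t}}{\binom{v}{t}}$, $\ F=\dfrac{\binom{v}{t}}{\binom{k}{t}}$; 3) $K=\dfrac{\binom{v}{t}}{\binom{k}{t}}$, $\ \frac{M}{N}=1-\dfrac{\binom{k}{t_0}}{\binom{v}{t_0}}$, $\ R=1$, $\ F=\binom{v}{t_0}$.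
   Context: $t$-design: let $v,k,\lambda,t$ be positive integers with $v>k\geq t$. A $t$-$(v,k,\lambda)$-design is a pair $(V,\mathcal{B})$, where $V$ is a set of points with $|V|=v$ and $\mathcal{B}$ is a collection (multiset) of $k$-subsets of $V$ (blocks), such that every $t$-subset of $V$ is contained in exactly $\lambda$ blocks. Its number of blocks is $\lambda\binom{v}{t}/\binom{k}{t}$. Caching system and caching scheme: fix a finite field $\mathbb{F}$ (e.g. $\mathbb{F}=\mathbb{F}_2$), and write $[n]=\{1,\dots,n\}$. A $(K,M,N)$ caching system consists of one server with $N$ files $\mathbf{W}_1,\dots,\mathbf{W}_N$ and $K$ users, each with a cache of size $M$, $0\le M\le N$. For a positive integer $F$ (the subpacketization; with $MF$ an integer), each file is a vector $\mathbf{W}_i\in\mathbb{F}^F$. An $F$-division caching scheme with rate $R$ for the $(K,M,N)$ caching system consists of: caching functions $\phi_k:\mathbb{F}^{NF}\to\mathbb{F}^{MF}$ for $k\in[K]$; encoding functions $\varphi_{\mathbf{d}}:\mathbb{F}^{NF}\to\mathbb{F}^{\lfloor RF\rfloor}$ for $\mathbf{d}\in[N]^K$; and decoding functions $\mu_{k,\mathbf{d}}:\mathbb{F}^{MF}\times\mathbb{F}^{\lfloor RF\rfloor}\to\mathbb{F}^{F}$ for $k\in[K]$, $\mathbf{d}\in[N]^K$; such that for all $k\in[K]$, all $\mathbf{d}=(d_1,\dots,d_K)\in[N]^K$, and all files $\mathbf{W}_1,\dots,\mathbf{W}_N\in\mathbb{F}^F$, $$\mathbf{W}_{d_k}=\mu_{k,\mathbf{d}}\bigl(\phi_k(\mathbf{W}_1,\dots,\mathbf{W}_N),\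 \varphi_{\mathbf{d}}(\mathbf{W}_1,\dots,\mathbf{W}_N)\bigr).$$ (Here the user index $k\in[K]$ is unrelated to the block size $k$.) *)

theory Defs
  imports Complex_Main "HOL-Library.Multiset" "HOL-Library.FuncSet" "Jordan_Normal_Form.Matrix"
begin

definition t_design ::
  "nat \<Rightarrow> nat \<Rightarrow> nat \<Rightarrow> nat \<Rightarrow> 'p set \<Rightarrow> 'p set multiset \<Rightarrow> bool" where
  "t_design t v k l V \<B> \<longleftrightarrow>
     0 < t \<and> 0 < l \<and> t \<le> k \<and> k < v \<and>
     finite V \<and> card V = v \<and>
     (\<forall>b \<in># \<B>. b \<subseteq> V \<and> card b = k) \<and>
     (\<forall>T. T \<subseteq> V \<and> card T = t \<longrightarrow> size {#b \<in># \<B>. T \<subseteq> b#} = l)"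

definition caching_system :: "nat \<Rightarrow> real \<Rightarrow> nat \<Rightarrow> bool" where
  "caching_system K M N \<longleftrightarrow> 0 < K \<and> 0 < N \<and> 0 \<le> M \<and> M \<le> real N"

text \<open>The tuple of files \<open>W 1, \<dots>, W N\<close>, each of length \<open>F\<close>, identified with
  the concatenated vector of length \<open>N * F\<close>. Vector entries are indexed from 0.\<close>

definition concat_files :: "nat \<Rightarrow> nat \<Rightarrow> (nat \<Rightarrow> 'f vec) \<Rightarrow> 'f vec" where
  "concat_files N F W = vec (N * F) (\<lambda>i. W (i div F + 1) $ (i mod F))"

text \<open>The space of vectors of length \<open>n\<close> over the alphabet \<open>'f\<close> is \<open>carrier_vec n\<close>.
  The requirements that \<open>M * F\<close> is an integer and \<open>R\<close> is nonnegative (together with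
  \<open>0 \<le> M\<close>) ensure that the conversions by \<open>nat\<close> lose nothing.\<close>

definition caching_scheme ::
  "nat \<Rightarrow> real \<Rightarrow> nat \<Rightarrow> nat \<Rightarrow> real \<Rightarrow>
   (nat \<Rightarrow> 'f vec \<Rightarrow> 'f vec) \<Rightarrow>
   ((nat \<Rightarrow> nat) \<Rightarrow> 'f vec \<Rightarrow> 'f vec) \<Rightarrow>
   (nat \<Rightarrow> (nat \<Rightarrow> nat) \<Rightarrow> 'f::{field,finite} vec \<times> 'f vec \<Rightarrow> 'f vec) \<Rightarrow> bool" where
  "caching_scheme K M N F R \<phi> enc \<mu> \<longleftrightarrow>
     caching_system K M N \<and> 0 < F \<and> M * real F \<in> \<int> \<and> 0 \<le> R \<and>
     (\<forall>k \<in> {1..K}. \<phi> k \<in> carrier_vec (N * F) \<rightarrow> carrier_vec (nat \<lfloor>M * real F\<rfloor>)) \<and>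
     (\<forall>d \<in> {1..K} \<rightarrow>\<^sub>E {1..N}.
        enc d \<in> carrier_vec (N * F) \<rightarrow> carrier_vec (nat \<lfloor>R * real F\<rfloor>)) \<and>
     (\<forall>k \<in> {1..K}. \<forall>d \<in> {1..K} \<rightarrow>\<^sub>E {1..N}.
        \<mu> k d \<in> carrier_vec (nat \<lfloor>M * real F\<rfloor>) \<times> carrier_vec (nat \<lfloor>R * real F\<rfloor>)
                  \<rightarrow> carrier_vec F) \<and>
     (\<forall>k \<in> {1..K}. \<forall>d \<in> {1..K} \<rightarrow>\<^sub>E {1..N}. \<forall>W \<in> {1..N} \<rightarrow> carrier_vec F.
        W (d k) = \<mu> k d (\<phi> k (concat_files N F W), enc d (concat_files N F W)))"

text \<open>The type argument names the finite field, which the other parameters do not determine.\<close>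

definition admits_caching_scheme ::
  "'f::{field,finite} itself \<Rightarrow> nat \<Rightarrow> real \<Rightarrow> nat \<Rightarrow> nat \<Rightarrow> real \<Rightarrow> bool" where
  "admits_caching_scheme _ K M N F R \<longleftrightarrow>
     (\<exists>(\<phi> :: nat \<Rightarrow> 'f vec \<Rightarrow> 'f vec) enc \<mu>. caching_scheme K M N F R \<phi> enc \<mu>)"

end

theory Submission
  imports Defs
begin

text \<open>
  Since \<open>t\<^sub>0 \<le> t - 1 \<le> k / 2\<close>, the disjointness graph on the \<open>t\<^sub>0\<close>-subsets of a block \<open>b\<close> is regular
  of positive degree, so Hall's theorem yields a permutation \<open>f b\<close> of these subsets with
  \<open>A \<inter> f b A = {}\<close>. As \<open>2 * t\<^sub>0 \<ge> t\<close>, the union \<open>A \<union> f b A\<close> lies in no other block. Hence the triples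
  \<open>(A, b, f b A)\<close> satisfy the defining condition of a placement delivery array, which is symmetric
  in the three coordinates. Letting the coordinates play the roles of users, packets and
  transmissions in three different orders gives the three schemes: a user caches the starred
  packets of all files, and each transmission is the sum of the requested packets carrying its
  symbol, all but one of which are cached by any user involved.
\<close>

section \<open>Hall's theorem and disjoint partners of subsets\<close>

text \<open>Rado's argument, by induction on the total size of the sets: from a set with two
  distinct elements, one of the two can be deleted without violating Hall's condition. Once no set
  has two elements, the condition for pairs of indices makes the choice injective.\<close>

lemma hall_marriage:
  fixes A :: "'i \<Rightarrow> 'a set"
  assumes "finite I" and "\<And>i. i \<in> I \<Longrightarrow> finite (A i)"
    and "\<And>J. J \<subseteq> I \<Longrightarrow> card J \<le> card (\<Union>(A ` J))"
  shows "\<exists>f. inj_on f I \<and> (\<forall>i\<in>I. f i \<in> A i)"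
  using assms(2,3)
proof (induction "\<Sum>i\<in>I. card (A i)" arbitrary: A rule: less_induct)
  case less
  note fin = less.prems(1) and hall = less.prems(2)
  have nonempty: "A i \<noteq> {}" if "i \<in> I" for i
    using hall[of "{i}"] that by auto
  show ?case
  proof (cases "\<exists>i\<in>I. \<exists>x\<in>A i. \<exists>y\<in>A i. x \<noteq> y")
    case True
    then obtain i x y where i: "i \<in> I" and x: "x \<in> A i" and y: "y \<in> A i" and "x \<noteq> y"
      by blast
    define A' where "A' z = A(i := A i - {z})" for z
    have sub: "A' z j \<subseteq> A j" for z j
      by (auto simp: A'_def)
    have smaller: "(\<Sum>j\<in>I. card (A' z j)) < (\<Sum>j\<in>I. card (A j))" if "z \<in> A i" for z
    proof (rule sum_strict_mono_ex1[OF assms(1)])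
      show "\<forall>j\<in>I. card (A' z j) \<le> card (A j)"
        using card_mono[OF fin sub] by blast
      show "\<exists>j\<in>I. card (A' z j) < card (A j)"
        using i that card_Diff1_less[OF fin[OF i]] by (intro bexI[of _ i]) (simp_all only: A'_def fun_upd_same)
    qed
    have "\<exists>z\<in>{x, y}. \<forall>J\<subseteq>I. card J \<le> card (\<Union>(A' z ` J))"
    proof (rule ccontr)
      assume contra: "\<not> ?thesis"
      \<comment> \<open>Deleting \<open>z\<close> changes only \<open>A i\<close>, so a family
        violating the condition contains \<open>i\<close>. Dropping \<open>i\<close> from it turns
        the strict inequality into a weak one.\<close>
      have violator: "\<exists>J. J \<subseteq> I \<and> i \<notin> J \<and> card (\<Union>(A ` J) \<union> (A i - {z})) \<le> card J"
        if z: "z \<in> {x, y}" for z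
      proof -
        obtain J where J: "J \<subseteq> I" "card (\<Union>(A' z ` J)) < card J"
        proof -
          have "\<not> (\<forall>J\<subseteq>I. card J \<le> card (\<Union>(A' z ` J)))"
          proof
            assume "\<forall>J\<subseteq>I. card J \<le> card (\<Union>(A' z ` J))"
            then have "\<exists>z\<in>{x, y}. \<forall>J\<subseteq>I. card J \<le> card (\<Union>(A' z ` J))"
              using z by (rule bexI)
            with contra show False ..
          qed
          then show ?thesis
            using that by (auto simp: not_le)
        qed
        have "i \<in> J"
        proof (rule ccontr)
          assume "i \<notin> J"
          then have "\<Union>(A' z ` J) = \<Union>(A ` J)"
            by (auto simp: A'_def)
          then show False
            using hall[OF J(1)] J(2) by simp
        qed
        moreover have "\<Union>(A ` (J - {i})) \<union> (A i - {z}) = \<Union>(A' z ` J)"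
          using \<open>i \<in> J\<close> by (auto simp: A'_def split: if_splits)
        moreover have "card (J - {i}) = card J - 1"
          using \<open>i \<in> J\<close> J(1) assms(1) by (meson card_Diff_singleton)
        ultimately show ?thesis
          using J by (intro exI[of _ "J - {i}"]) auto
      qed
      obtain J where J: "J \<subseteq> I" "i \<notin> J" "card (\<Union>(A ` J) \<union> (A i - {x})) \<le> card J"
        using violator[of x] by auto
      obtain L where L: "L \<subseteq> I" "i \<notin> L" "card (\<Union>(A ` L) \<union> (A i - {y})) \<le> card L"
        using violator[of y] by auto
      let ?P = "\<Union>(A ` J) \<union> (A i - {x})" and ?Q = "\<Union>(A ` L) \<union> (A i - {y})"
      have finJL: "finite J" "finite L"
        using J L assms(1) finite_subset by auto
      have finPQ: "finite ?P" "finite ?Q"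
        using J L i fin finJL by (auto intro!: finite_UN_I)
      \<comment> \<open>Submodularity of cardinality: since \<open>x\<close> and \<open>y\<close>
        differ, \<open>?P \<union> ?Q\<close> recovers all of \<open>A i\<close>, so Hall's
        condition for the family with \<open>i\<close> gives an extra 1. Together with the bound for
        \<open>J \<inter> L\<close>, this exceeds what the two violators allow.\<close>
      have "?P \<union> ?Q = \<Union>(A ` insert i (J \<union> L))"
        using \<open>x \<noteq> y\<close> by auto
      then have union: "card (J \<union> L) + 1 \<le> card (?P \<union> ?Q)"
        using hall[of "insert i (J \<union> L)"] i J L finJL by simp
      have "card (J \<inter> L) \<le> card (\<Union>(A ` (J \<inter> L)))"
        using hall J(1) by blast
      also have "\<dots> \<le> card (?P \<inter> ?Q)"
        using finPQ by (intro card_mono) auto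
      finally have "card (J \<inter> L) \<le> card (?P \<inter> ?Q)" .
      then show False
        using union J(3) L(3) card_Un_Int[OF finJL] card_Un_Int[OF finPQ] by linarith
    qed
    then obtain z where z: "z \<in> A i" "\<And>J. J \<subseteq> I \<Longrightarrow> card J \<le> card (\<Union>(A' z ` J))"
      using x y by blast
    have "finite (A' z j)" if "j \<in> I" for j
      using finite_subset[OF sub fin[OF that]] .
    then have "\<exists>f. inj_on f I \<and> (\<forall>i\<in>I. f i \<in> A' z i)"
      by (rule less.hyps[OF smaller[OF z(1)] _ z(2)])
    then show ?thesis
      using sub by blast
  next
    case False
    define f where "f i = (SOME x. x \<in> A i)" for i
    have f: "f i \<in> A i" if "i \<in> I" for i
      using nonempty[OF that] by (simp add: f_def some_in_eq)
    have "inj_on f I"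
    proof (rule inj_onI, rule ccontr)
      fix i j assume ij: "i \<in> I" "j \<in> I" "f i = f j" "i \<noteq> j"
      have "\<Union>(A ` {i, j}) = {f i}"
      proof -
        have "A i = {f i}" "A j = {f j}"
          using False f ij(1,2) by blast+
        then show ?thesis
          using ij(3) by simp
      qed
      then show False
        using hall[of "{i, j}"] ij by simp
    qed
    with f show ?thesis
      by blast
  qed
qed

text \<open>Every vertex of the disjointness graph has degree \<open>D > 0\<close>, so counting the
  edges at \<open>J\<close> and at its neighbourhood gives Hall's condition. The resulting injective
  self-map of a finite set is a bijection.\<close>

lemma ex_disjoint_subset_permutation:
  assumes "finite B" and "2 * s \<le> card B"
  shows "\<exists>f. bij_betw f {A. A \<subseteq> B \<and> card A = s} {A. A \<subseteq> B \<and> card A = s} \<and>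
             (\<forall>A. A \<subseteq> B \<and> card A = s \<longrightarrow> A \<inter> f A = {})"
proof -
  define P where "P = {A. A \<subseteq> B \<and> card A = s}"
  define nb where "nb A = {C \<in> P. A \<inter> C = {}}" for A
  define D where "D = (card B - s) choose s"
  have "finite P"
    using assms(1) by (simp add: P_def)
  then have fin_nb: "finite (nb A)" for A
    by (simp add: nb_def)
  have "D > 0"
    using assms(2) by (simp add: D_def)
  have degree: "card (nb A) = D" if "A \<in> P" for A
  proof -
    have "nb A = {C. C \<subseteq> B - A \<and> card C = s}"
      by (auto simp: nb_def P_def)
    moreover have "card (B - A) = card B - s"
      using that assms(1) by (auto simp: P_def card_Diff_subset finite_subset)
    ultimately show ?thesis
      using n_subsets[of "B - A" s] assms(1) by (simp add: D_def)
  qed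
  have hall: "card J \<le> card (\<Union>(nb ` J))" if J: "J \<subseteq> P" for J
  proof -
    let ?N = "\<Union>(nb ` J)"
    have finJ: "finite J" and N: "?N \<subseteq> P"
      using J \<open>finite P\<close> finite_subset by (auto simp: nb_def)
    have "card (Sigma J nb) = card J * D"
      using finJ fin_nb J degree by (subst card_SigmaI) (auto intro: sum.cong simp: subset_iff)
    moreover have "card (Sigma ?N nb) = card ?N * D"
      using N \<open>finite P\<close> fin_nb degree
      by (subst card_SigmaI) (auto intro: finite_subset simp: subset_iff)
    \<comment> \<open>Disjointness is symmetric, so reversing an edge that leaves \<open>J\<close>
      gives an edge that leaves a neighbour of \<open>J\<close>.\<close>
    moreover have "prod.swap ` Sigma J nb \<subseteq> Sigma ?N nb"
      using J by (auto simp: nb_def Int_commute subset_iff)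
    then have "card (prod.swap ` Sigma J nb) \<le> card (Sigma ?N nb)"
      using finJ fin_nb by (intro card_mono) auto
    then have "card (Sigma J nb) \<le> card (Sigma ?N nb)"
      by (simp add: card_image)
    ultimately show ?thesis
      using \<open>D > 0\<close> by simp
  qed
  have "\<exists>f. inj_on f P \<and> (\<forall>A\<in>P. f A \<in> nb A)"
    using \<open>finite P\<close> fin_nb hall by (rule hall_marriage)
  then obtain f where f: "inj_on f P" "\<forall>A\<in>P. f A \<in> nb A"
    by blast
  then have "f ` P \<subseteq> P"
    by (auto simp: nb_def)
  then have "bij_betw f P P"
    using f(1) \<open>finite P\<close> by (simp add: bij_betw_def endo_inj_surj)
  moreover have "\<forall>A. A \<subseteq> B \<and> card A = s \<longrightarrow> A \<inter> f A = {}"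
    using f(2) by (auto simp: nb_def P_def)
  ultimately show ?thesis
    unfolding P_def by blast
qed

section \<open>Counting in Steiner systems\<close>

text \<open>Adjoining \<open>A\<close> is a bijection from the subsets of \<open>V - A\<close> of
  size \<open>t - card A\<close>; removing \<open>A\<close> is its inverse.\<close>

lemma card_intermediate_subsets:
  assumes "finite V" and "A \<subseteq> V" and "card A \<le> t"
  shows "card {T. A \<subseteq> T \<and> T \<subseteq> V \<and> card T = t} = (card V - card A) choose (t - card A)"
proof -
  have finA: "finite A"
    using assms finite_subset by blast
  have fin: "finite T" if "T \<subseteq> V" for T
    using assms(1) that finite_subset by blast
  have "bij_betw (\<lambda>T. T \<union> A) {T. T \<subseteq> V - A \<and> card T = t - card A}
          {T. A \<subseteq> T \<and> T \<subseteq> V \<and> card T = t}"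
  proof (rule bij_betw_byWitness[where f' = "\<lambda>T. T - A"])
    show "(\<lambda>T. T \<union> A) ` {T. T \<subseteq> V - A \<and> card T = t - card A}
            \<subseteq> {T. A \<subseteq> T \<and> T \<subseteq> V \<and> card T = t}"
    proof clarify
      fix T assume T: "T \<subseteq> V - A" "card T = t - card A"
      then have "card (T \<union> A) = t"
        using fin[of T] finA assms(3) by (subst card_Un_disjoint) auto
      with T assms(2) show "A \<subseteq> T \<union> A \<and> T \<union> A \<subseteq> V \<and> card (T \<union> A) = t"
        by auto
    qed
    show "(\<lambda>T. T - A) ` {T. A \<subseteq> T \<and> T \<subseteq> V \<and> card T = t}
            \<subseteq> {T. T \<subseteq> V - A \<and> card T = t - card A}"
      using finA by (auto simp: card_Diff_subset)
  qed auto
  then have "card {T. A \<subseteq> T \<and> T \<subseteq> V \<and> card T = t}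
             = card {T. T \<subseteq> V - A \<and> card T = t - card A}"
    by (simp add: bij_betw_same_card)
  then show ?thesis
    using assms n_subsets[of "V - A" "t - card A"] by (simp add: card_Diff_subset finA)
qed

lemma steiner_block_exists:
  assumes "t_design t v k 1 V \<B>" and "T \<subseteq> V" and "card T = t"
  shows "\<exists>b\<in>#\<B>. T \<subseteq> b"
proof -
  have "size {#b \<in># \<B>. T \<subseteq> b#} = 1"
    using assms by (auto simp: t_design_def)
  then have "{#b \<in># \<B>. T \<subseteq> b#} \<noteq> {#}"
    by force
  then obtain b where "b \<in># {#b \<in># \<B>. T \<subseteq> b#}"
    by (rule multiset_nonemptyE)
  then show ?thesis
    by auto
qed

text \<open>Some \<open>t\<close>-subset of \<open>S\<close> lies in both blocks, and the multiset
  of blocks around it is a singleton.\<close>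

lemma steiner_block_unique:
  assumes "t_design t v k 1 V \<B>" and "b \<in># \<B>" and "b' \<in># \<B>"
    and "S \<subseteq> b" and "S \<subseteq> b'" and "t \<le> card S"
  shows "b = b'"
proof -
  obtain T where T: "T \<subseteq> S" "card T = t"
    using assms(6) by (meson obtain_subset_with_card_n)
  moreover have "b \<subseteq> V"
    using assms by (auto simp: t_design_def)
  ultimately have "size {#b \<in># \<B>. T \<subseteq> b#} = 1"
    using assms by (auto simp: t_design_def)
  then obtain c where "{#b \<in># \<B>. T \<subseteq> b#} = {#c#}"
    using size_1_singleton_mset by blast
  moreover have "b \<in># {#b \<in># \<B>. T \<subseteq> b#}" "b' \<in># {#b \<in># \<B>. T \<subseteq> b#}"
    using assms T by auto
  ultimately show ?thesis
    by auto
qed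

text \<open>Each \<open>t\<close>-set of points containing \<open>A\<close> lies in exactly one
  block, so the blocks through \<open>A\<close> partition these \<open>t\<close>-sets into classes
  of equal size. The case \<open>A = {}\<close> yields the number of blocks, the case of a
  \<open>t\<^sub>0\<close>-set the replication number.\<close>

lemma steiner_blocks_containing:
  assumes design: "t_design t v k 1 V \<B>" and A: "A \<subseteq> V" "card A \<le> t"
  shows "card {b \<in> set_mset \<B>. A \<subseteq> b} * ((k - card A) choose (t - card A))
         = (v - card A) choose (t - card A)"
proof -
  define Bs where "Bs = {b \<in> set_mset \<B>. A \<subseteq> b}"
  define M where "M b = {T. A \<subseteq> T \<and> T \<subseteq> b \<and> card T = t}" for b
  have V: "finite V" "card V = v"
    and blocks: "\<And>b. b \<in># \<B> \<Longrightarrow> b \<subseteq> V \<and> finite b \<and> card b = k"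
    using design by (auto simp: t_design_def intro: finite_subset)
  have "M V = \<Union>(M ` Bs)"
  proof
    show "M V \<subseteq> \<Union>(M ` Bs)"
    proof
      fix T assume T: "T \<in> M V"
      then obtain b where "b \<in># \<B>" "T \<subseteq> b"
        using steiner_block_exists[OF design, of T] by (auto simp: M_def)
      then show "T \<in> \<Union>(M ` Bs)"
        using T by (auto simp: M_def Bs_def)
    qed
    show "\<Union>(M ` Bs) \<subseteq> M V"
      using blocks by (fastforce simp: M_def Bs_def)
  qed
  then have "card (M V) = card (\<Union>(M ` Bs))"
    by simp
  also have "\<dots> = (\<Sum>b\<in>Bs. card (M b))"
  proof (rule card_UN_disjoint)
    show "finite Bs"
      by (simp add: Bs_def)
    show "\<forall>b\<in>Bs. finite (M b)"
      using blocks by (auto simp: Bs_def M_def)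
    show "\<forall>b\<in>Bs. \<forall>b'\<in>Bs. b \<noteq> b' \<longrightarrow> M b \<inter> M b' = {}"
    proof (intro ballI impI, rule ccontr)
      fix b b' assume b: "b \<in> Bs" "b' \<in> Bs" "b \<noteq> b'" "M b \<inter> M b' \<noteq> {}"
      then obtain S where "S \<subseteq> b" "S \<subseteq> b'" "card S = t"
        by (auto simp: M_def)
      then show False
        using steiner_block_unique[OF design, of b b' S] b by (auto simp: Bs_def)
    qed
  qed
  also have "\<dots> = (\<Sum>b\<in>Bs. (k - card A) choose (t - card A))"
    unfolding M_def
  proof (rule sum.cong[OF refl])
    fix b assume "b \<in> Bs"
    then have "finite b" "card b = k" "A \<subseteq> b"
      using blocks by (auto simp: Bs_def)
    then show "card {T. A \<subseteq> T \<and> T \<subseteq> b \<and> card T = t} = (k - card A) choose (t - card A)"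
      using card_intermediate_subsets A(2) by blast
  qed
  finally show ?thesis
    using card_intermediate_subsets[OF V(1) A] V(2) by (simp add: M_def Bs_def)
qed

section \<open>Caching schemes from placement delivery arrays\<close>

text \<open>A triple \<open>(u, x, c)\<close> says that the entry of a placement delivery array in row \<open>x\<close>
  (a packet) and column \<open>u\<close> (a user) is the symbol \<open>c\<close> (a transmission); positions without a
  triple are the stars. The condition below is invariant under permuting the three coordinates.\<close>

definition triangle_free :: "('a \<times> 'b \<times> 'c) set \<Rightarrow> bool" where
  "triangle_free T \<longleftrightarrow> (\<forall>a a' b b' c c'.
     (a', b, c) \<in> T \<and> (a, b', c) \<in> T \<and> (a, b, c') \<in> T \<longrightarrow> a' = a \<and> b' = b \<and> c' = c)"

lemma triangle_freeD:
  "triangle_free T \<Longrightarrow> (a', b, c) \<in> T \<Longrightarrow> (a, b', c) \<in> T \<Longrightarrow> (a, b, c') \<in> T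
   \<Longrightarrow> a' = a \<and> b' = b \<and> c' = c"
  unfolding triangle_free_def by blast

text \<open>File numbers start at 1 and vector positions at 0, hence the offset
  \<open>n - 1\<close>.\<close>

lemma concat_files_index:
  assumes "n \<in> {1..N}" and "j < F"
  shows "(n - 1) * F + j < N * F" and "concat_files N F W $ ((n - 1) * F + j) = W n $ j"
proof -
  have "(n - 1) * F + j < (n - 1) * F + F"
    using assms(2) by simp
  also have "\<dots> = n * F"
    using assms(1) by (cases n) auto
  also have "\<dots> \<le> N * F"
    using assms(1) by simp
  finally show *: "(n - 1) * F + j < N * F" .
  show "concat_files N F W $ ((n - 1) * F + j) = W n $ j"
    using * assms by (simp add: concat_files_def)
qed

text \<open>Decoders need not be written down: it suffices that the cache content and the
  transmission determine the requested file.\<close>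

lemma admits_caching_schemeI:
  fixes \<phi> :: "nat \<Rightarrow> 'f::{field,finite} vec \<Rightarrow> 'f vec"
    and enc :: "(nat \<Rightarrow> nat) \<Rightarrow> 'f vec \<Rightarrow> 'f vec"
  assumes "caching_system K M N" and "0 < F"
    and m: "M * real F = real m" and r: "R * real F = real r"
    and \<phi>: "\<And>k w. \<phi> k w \<in> carrier_vec m"
    and enc: "\<And>d w. enc d w \<in> carrier_vec r"
    and det: "\<And>k d w w' j. k \<in> {1..K} \<Longrightarrow> d \<in> {1..K} \<rightarrow>\<^sub>E {1..N} \<Longrightarrow> j < F \<Longrightarrow>
        \<phi> k w = \<phi> k w' \<Longrightarrow> enc d w = enc d w' \<Longrightarrow>
        w $ ((d k - 1) * F + j) = w' $ ((d k - 1) * F + j)"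
  shows "admits_caching_scheme TYPE('f) K M N F R"
proof -
  define pick :: "nat \<Rightarrow> 'f vec \<Rightarrow> 'f vec"
    where "pick n w = vec F (\<lambda>j. w $ ((n - 1) * F + j))" for n w
  \<comment> \<open>The decoder reads the requested file off an arbitrary preimage of the received
    pair; \<open>det\<close> makes the choice irrelevant. On pairs without a preimage it still
    returns a vector of length \<open>F\<close>.\<close>
  define \<mu> where "\<mu> k d p = pick (d k) (SOME w. (\<phi> k w, enc d w) = p)" for k d p
  have decode: "W (d k) = \<mu> k d (\<phi> k (concat_files N F W), enc d (concat_files N F W))"
    if k: "k \<in> {1..K}" and d: "d \<in> {1..K} \<rightarrow>\<^sub>E {1..N}" and W: "W \<in> {1..N} \<rightarrow> carrier_vec F"
    for k d W
  proof -
    let ?w = "concat_files N F W"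
    define w' where "w' = (SOME w'. (\<phi> k w', enc d w') = (\<phi> k ?w, enc d ?w))"
    have "(\<phi> k w', enc d w') = (\<phi> k ?w, enc d ?w)"
      unfolding w'_def by (rule someI[of _ ?w]) simp
    then have eq: "\<phi> k w' = \<phi> k ?w" "enc d w' = enc d ?w"
      by auto
    have dk: "d k \<in> {1..N}"
      using d k by auto
    have "pick (d k) w' = W (d k)"
    proof (rule eq_vecI)
      show dim: "dim_vec (pick (d k) w') = dim_vec (W (d k))"
        using Pi_mem[OF W dk] by (simp add: pick_def)
      fix j assume "j < dim_vec (W (d k))"
      then have "j < F"
        using dim by (simp add: pick_def)
      then show "pick (d k) w' $ j = W (d k) $ j"
        using det[OF k d _ eq] concat_files_index(2)[OF dk] by (simp add: pick_def)
    qed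
    then show ?thesis
      by (simp add: \<mu>_def w'_def)
  qed
  have "0 \<le> R"
    using r \<open>0 < F\<close> zero_le_mult_iff[of R "real F"] by simp
  moreover have "M * real F \<in> \<int>"
    using m by simp
  moreover have "\<mu> k d p \<in> carrier_vec F" for k d p
    by (simp add: \<mu>_def pick_def)
  ultimately have "caching_scheme K M N F R \<phi> enc \<mu>"
    unfolding caching_scheme_def m r using assms(1,2) \<phi> enc decode by simp
  then show ?thesis
    unfolding admits_caching_scheme_def by blast
qed

text \<open>A packet is a single field element. A user lacks \<open>D\<close> packets of each file
  and stores the rest, and one field element is sent for each symbol in \<open>C\<close>; this
  accounts for the ratio and the rate.\<close>

lemma triangle_free_caching_scheme:
  fixes T :: "('u \<times> 'x \<times> 'c) set" and M :: real
  assumes fin: "finite U" "finite X" "finite C" and "X \<noteq> {}"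
    and T: "T \<subseteq> U \<times> X \<times> C" "triangle_free T"
    and degree: "\<And>u. u \<in> U \<Longrightarrow> card {x \<in> X. \<exists>c. (u, x, c) \<in> T} = D"
    and sys: "caching_system (card U) M N"
    and ratio: "M / real N = 1 - real D / real (card X)"
  shows "admits_caching_scheme TYPE('f::{field,finite}) (card U) M N (card X)
           (real (card C) / real (card X))"
proof -
  define F where "F = card X"
  define Z where "Z = F - D"
  obtain u where u: "bij_betw u {1..card U} U"
    using ex_bij_betw_nat_finite_1[OF fin(1)] by blast
  obtain x where x: "bij_betw x {0..<F} X"
    using ex_bij_betw_nat_finite[OF fin(2)] unfolding F_def by blast
  obtain c where c: "bij_betw c {0..<card C} C"
    using ex_bij_betw_nat_finite[OF fin(3)] by blast
  have "0 < F"
    using fin \<open>X \<noteq> {}\<close> by (simp add: F_def card_gt_0_iff)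
  have "0 < card U" "0 < N"
    using sys by (auto simp: caching_system_def)
  \<comment> \<open>The degree condition at one user bounds \<open>D\<close> by \<open>F\<close>, so
    the natural subtraction in \<open>Z\<close> does not truncate.\<close>
  then obtain u0 where "u0 \<in> U"
    by (metis card_gt_0_iff ex_in_conv)
  then have "D \<le> F"
    using degree fin(2) card_mono[of X "{x \<in> X. \<exists>c. (u0, x, c) \<in> T}"] by (auto simp: F_def)
  have MF: "M * real F = real (N * Z)"
  proof -
    have "M = real N * (1 - real D / real F)"
      using ratio \<open>0 < N\<close> by (simp add: F_def divide_eq_eq mult.commute)
    then show ?thesis
      using \<open>0 < F\<close> \<open>D \<le> F\<close> by (simp add: Z_def of_nat_diff right_diff_distrib left_diff_distrib)
  qed
  define star where "star k = {j \<in> {0..<F}. \<forall>s. (u k, x j, s) \<notin> T}" for k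
  have card_star: "card (star k) = Z" if "k \<in> {1..card U}" for k
  proof -
    have uk: "u k \<in> U"
      using u that by (auto simp: bij_betw_def)
    have "x ` star k = X - {x \<in> X. \<exists>c. (u k, x, c) \<in> T}"
      using x by (auto simp: star_def bij_betw_def)
    moreover have "inj_on x (star k)"
      using x by (auto simp: bij_betw_def star_def intro: inj_on_subset)
    ultimately show ?thesis
      using degree[OF uk] fin(2) card_Diff_subset[of "{x \<in> X. \<exists>c. (u k, x, c) \<in> T}" X]
      by (simp add: F_def Z_def flip: card_image)
  qed
  \<comment> \<open>The cache of user \<open>k\<close> is laid out by enumerating the pairs of a
    file number, counted from 0, and a starred packet.\<close>
  have "\<exists>g. bij_betw g {0..<N * Z} ({0..<N} \<times> star k)" if "k \<in> {1..card U}" for k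
  proof -
    have "finite ({0..<N} \<times> star k)" "card ({0..<N} \<times> star k) = N * Z"
      using card_star[OF that] by (auto simp: star_def card_cartesian_product)
    then show ?thesis
      using ex_bij_betw_nat_finite by metis
  qed
  then obtain g where g: "\<And>k. k \<in> {1..card U} \<Longrightarrow> bij_betw (g k) {0..<N * Z} ({0..<N} \<times> star k)"
    by metis
  define \<phi> :: "nat \<Rightarrow> 'f vec \<Rightarrow> 'f vec"
    where "\<phi> k w = vec (N * Z) (\<lambda>i. case g k i of (n, j) \<Rightarrow> w $ (n * F + j))" for k w
  define E where "E s = {(k, j). k \<in> {1..card U} \<and> j \<in> {0..<F} \<and> (u k, x j, c s) \<in> T}" for s
  define enc :: "(nat \<Rightarrow> nat) \<Rightarrow> 'f vec \<Rightarrow> 'f vec"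
    where "enc d w = vec (card C) (\<lambda>s. \<Sum>(k, j)\<in>E s. w $ ((d k - 1) * F + j))" for d w
  have finE: "finite (E s)" for s
    by (rule finite_subset[of _ "{1..card U} \<times> {0..<F}"]) (auto simp: E_def)
  show ?thesis
    unfolding F_def[symmetric]
  proof (rule admits_caching_schemeI[where m = "N * Z" and r = "card C" and \<phi> = \<phi> and enc = enc])
    fix k d j and w w' :: "'f vec"
    assume k: "k \<in> {1..card U}" and d: "d \<in> {1..card U} \<rightarrow>\<^sub>E {1..N}" and "j < F"
      and eq: "\<phi> k w = \<phi> k w'" "enc d w = enc d w'"
    \<comment> \<open>Equal caches agree on the starred packets of every file, in particular of the
      file requested by any other user \<open>k'\<close>.\<close>
    have cached: "w $ ((d k' - 1) * F + i) = w' $ ((d k' - 1) * F + i)"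
      if k': "k' \<in> {1..card U}" and i: "i \<in> star k" for k' i
    proof -
      have "d k' \<in> {1..N}"
        using d k' by auto
      then have "(d k' - 1, i) \<in> g k ` {0..<N * Z}"
        unfolding bij_betw_imp_surj_on[OF g[OF k]] using i by auto
      then obtain l where l: "l < N * Z" "g k l = (d k' - 1, i)"
        by (elim imageE) simp
      have "\<phi> k w $ l = \<phi> k w' $ l"
        using eq by simp
      then show ?thesis
        using l by (simp add: \<phi>_def)
    qed
    show "w $ ((d k - 1) * F + j) = w' $ ((d k - 1) * F + j)"
    proof (cases "j \<in> star k")
      case True
      then show ?thesis
        using cached k by blast
    next
      case False
      then obtain c0 where c0: "(u k, x j, c0) \<in> T"
        using \<open>j < F\<close> by (auto simp: star_def)
      then have "c0 \<in> c ` {0..<card C}"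
        unfolding bij_betw_imp_surj_on[OF c] using T(1) by auto
      then obtain s where s: "s < card C" "c0 = c s"
        by auto
      have kj: "(k, j) \<in> E s"
        using k \<open>j < F\<close> c0 s by (simp add: E_def)
      have others: "(case p of (k', i) \<Rightarrow> w $ ((d k' - 1) * F + i)) =
                    (case p of (k', i) \<Rightarrow> w' $ ((d k' - 1) * F + i))"
        if "p \<in> E s - {(k, j)}" for p
      proof -
        obtain k' i where p: "p = (k', i)"
          by fastforce
        then have k': "k' \<in> {1..card U}" and i: "i \<in> {0..<F}" and mem: "(u k', x i, c s) \<in> T"
          using that by (auto simp: E_def)
        \<comment> \<open>Otherwise the entries at \<open>(k', i)\<close>, \<open>(k, j)\<close> and
          \<open>(k, i)\<close> form the excluded configuration, which forces
          \<open>(k', i) = (k, j)\<close>.\<close>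
        have "i \<in> star k"
        proof (rule ccontr)
          assume "i \<notin> star k"
          then obtain c' where "(u k, x i, c') \<in> T"
            using i by (auto simp: star_def)
          then have "u k' = u k" "x j = x i"
            using triangle_freeD[OF T(2) mem] c0 s(2) by blast+
          then have "k' = k" "i = j"
            using u x k k' i \<open>j < F\<close> by (auto simp: bij_betw_def dest: inj_onD)
          then show False
            using that p by simp
        qed
        then show ?thesis
          using cached[OF k'] p by simp
      qed
      have "enc d w $ s = enc d w' $ s"
        using eq by simp
      then have "(\<Sum>(k, j)\<in>E s. w $ ((d k - 1) * F + j)) = (\<Sum>(k, j)\<in>E s. w' $ ((d k - 1) * F + j))"
        using s by (simp add: enc_def)
      moreover have "(\<Sum>(k, j)\<in>E s - {(k, j)}. w $ ((d k - 1) * F + j)) =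
                     (\<Sum>(k, j)\<in>E s - {(k, j)}. w' $ ((d k - 1) * F + j))"
        using others by (rule sum.cong[OF refl])
      ultimately show ?thesis
        by (simp add: sum.remove[OF finE kj])
    qed
  qed (use sys \<open>0 < F\<close> MF in \<open>auto simp: \<phi>_def enc_def\<close>)
qed

section \<open>Three schemes from one Steiner system\<close>

theorem theorem5:
  fixes V :: "'p set" and \<B> :: "'p set multiset" and t v k t\<^sub>0 :: nat
  assumes "t_design t v k 1 V \<B>"
    and "real t \<le> real k / 2 + 1"
    and "0 < t\<^sub>0" and "real t / 2 \<le> real t\<^sub>0" and "real t\<^sub>0 \<le> real t - 1"
  shows
    "(\<forall>K M N. caching_system K M N \<and>
        K = v choose t\<^sub>0 \<and>
        M / real N = 1 - real ((v - t\<^sub>0) choose (t - t\<^sub>0)) /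
                         (real ((k - t\<^sub>0) choose (t - t\<^sub>0)) * real (v choose t\<^sub>0)) \<longrightarrow>
        admits_caching_scheme TYPE('f::{field,finite}) K M N (v choose t\<^sub>0)
          (real (v choose t) / (real (k choose t) * real (v choose t\<^sub>0)))) \<and>
     (\<forall>K M N. caching_system K M N \<and>
        K = v choose t\<^sub>0 \<and>
        M / real N = 1 - real (k choose t\<^sub>0) / real (v choose t\<^sub>0) \<longrightarrow>
        (\<exists>F. real F = real (v choose t) / real (k choose t) \<and>
             admits_caching_scheme TYPE('f) K M N F
               (real (v choose t\<^sub>0) * real (k choose t) / real (v choose t)))) \<and>
     (\<forall>K M N. caching_system K M N \<and>
        real K = real (v choose t) / real (k choose t) \<and>
        M / real N = 1 - real (k choose t\<^sub>0) / real (v choose t\<^sub>0) \<longrightarrow>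
        admits_caching_scheme TYPE('f) K M N (v choose t\<^sub>0) 1)"
proof -
  note design = assms(1)
  have t: "t \<le> 2 * t\<^sub>0" "2 * t\<^sub>0 \<le> k" "t\<^sub>0 \<le> t" "t \<le> k" "k < v"
    using assms by (auto simp: t_design_def)
  have V: "finite V" "card V = v"
    and blocks: "\<And>b. b \<in># \<B> \<Longrightarrow> b \<subseteq> V \<and> finite b \<and> card b = k"
    using design by (auto simp: t_design_def intro: finite_subset)
  define P where "P b = {A. A \<subseteq> b \<and> card A = t\<^sub>0}" for b :: "'p set"
  have "\<exists>f. bij_betw f (P b) (P b) \<and> (\<forall>A\<in>P b. A \<inter> f A = {})" if "b \<in># \<B>" for b
    using ex_disjoint_subset_permutation[of b t\<^sub>0] blocks[OF that] t(2) unfolding P_def by auto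
  then obtain f where f: "\<And>b. b \<in># \<B> \<Longrightarrow> bij_betw (f b) (P b) (P b)"
    and disj: "\<And>b A. b \<in># \<B> \<Longrightarrow> A \<in> P b \<Longrightarrow> A \<inter> f b A = {}"
    by metis
  have f_P: "f b A \<in> P b" if "b \<in># \<B>" "A \<in> P b" for b A
    using f that by (auto simp: bij_betw_def)
  have finP: "finite (P V)" and cardP: "card (P V) = v choose t\<^sub>0"
    using V n_subsets[OF V(1)] by (auto simp: P_def)
  have P_mono: "A \<in> P V" if "b \<in># \<B>" "A \<in> P b" for b A
    using blocks[OF that(1)] that(2) by (auto simp: P_def)
  define T where "T = {(A, b, C). b \<in># \<B> \<and> A \<in> P b \<and> C = f b A}"
  have block_eq: "b' = b" if "(A, b, C) \<in> T" "b' \<in># \<B>" "A \<subseteq> b'" "C \<subseteq> b'" for A b C b'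
  proof -
    have b: "b \<in># \<B>" and AC: "A \<in> P b" "C \<in> P b" "A \<inter> C = {}"
      using that f_P disj by (auto simp: T_def)
    then have "finite A" "finite C"
      using blocks[OF b] by (auto simp: P_def intro: finite_subset)
    then have "card (A \<union> C) = 2 * t\<^sub>0"
      using AC by (simp add: card_Un_disjoint P_def)
    then show ?thesis
      using steiner_block_unique[OF design that(2) b, of "A \<union> C"] AC that t(1)
      by (auto simp: P_def)
  qed
  have T_free: "triangle_free T"
    unfolding triangle_free_def
  proof (intro allI impI, elim conjE)
    fix A A' b b' C C'
    assume T: "(A', b, C) \<in> T" "(A, b', C) \<in> T" "(A, b, C') \<in> T"
    \<comment> \<open>The third triple puts \<open>A\<close> into \<open>b\<close> and the first
      puts \<open>C\<close> into \<open>b\<close>, while the second assigns the pair to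
      \<open>b'\<close>; hence the blocks agree. Then \<open>C'\<close> and \<open>C\<close> are
      both \<open>f b A\<close>, and injectivity of \<open>f b\<close> gives
      \<open>A' = A\<close>.\<close>
    then have "b \<in># \<B>" "A \<in> P b" "C \<in> P b"
      using f_P[of b A'] by (auto simp: T_def)
    then have "b = b'"
      using block_eq[OF T(2), of b] by (auto simp: P_def)
    with T f[of b] show "A' = A \<and> b' = b \<and> C' = C"
      by (auto simp: T_def bij_betw_def dest: inj_onD)
  qed

  define \<beta> where "\<beta> = card (set_mset \<B>)"
  have \<beta>: "\<beta> * (k choose t) = v choose t"
    using steiner_blocks_containing[OF design, of "{}"] by (simp add: \<beta>_def)
  have pos: "0 < k choose t" "0 < v choose t" "0 < v choose t\<^sub>0" "0 < (k - t\<^sub>0) choose (t - t\<^sub>0)"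
    using t by auto
  have "0 < \<beta>"
    using \<beta> pos by (metis gr0I mult_0 less_irrefl)
  have \<beta>_real: "real \<beta> = real (v choose t) / real (k choose t)"
    using \<beta> pos by (simp add: field_simps flip: of_nat_mult)
  \<comment> \<open>The replication number: how many blocks pass through a given
    \<open>t\<^sub>0\<close>-set. The division is exact by \<open>containing\<close>.\<close>
  define r where "r = ((v - t\<^sub>0) choose (t - t\<^sub>0)) div ((k - t\<^sub>0) choose (t - t\<^sub>0))"
  have containing: "card {b \<in> set_mset \<B>. A \<subseteq> b} * ((k - t\<^sub>0) choose (t - t\<^sub>0)) = (v - t\<^sub>0) choose (t - t\<^sub>0)"
    if "A \<in> P V" for A
    using steiner_blocks_containing[OF design, of A] that t by (auto simp: P_def)
  have r: "card {b \<in> set_mset \<B>. A \<subseteq> b} = r" if "A \<in> P V" for A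
    using containing[OF that] pos by (metis nonzero_mult_div_cancel_right not_gr0 r_def)
  have "P V \<noteq> {}"
    using cardP pos by auto
  then have r_mult: "r * ((k - t\<^sub>0) choose (t - t\<^sub>0)) = (v - t\<^sub>0) choose (t - t\<^sub>0)"
    using containing r by auto
  \<comment> \<open>The goal is the double count of incidences between \<open>t\<^sub>0\<close>-sets
    and blocks. It is obtained by expanding both sides, times a common positive factor, to
    \<open>(v choose t) * (t choose t\<^sub>0)\<close>.\<close>
  have "r * (v choose t\<^sub>0) * ((k - t\<^sub>0) choose (t - t\<^sub>0)) = (v choose t) * (t choose t\<^sub>0)"
    using choose_mult[of t\<^sub>0 t v] t r_mult by (simp add: algebra_simps)
  also have "\<dots> = \<beta> * (k choose t\<^sub>0) * ((k - t\<^sub>0) choose (t - t\<^sub>0))"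
    using choose_mult[of t\<^sub>0 t k] t \<beta>[symmetric] by (simp add: algebra_simps)
  finally have r_\<beta>: "r * (v choose t\<^sub>0) = \<beta> * (k choose t\<^sub>0)"
    using pos by simp

  show ?thesis
  proof (intro conjI allI impI; elim conjE)
    fix K N :: nat and M :: real
    assume sys: "caching_system K M N" and K: "K = v choose t\<^sub>0"
      and ratio: "M / real N = 1 - real ((v - t\<^sub>0) choose (t - t\<^sub>0)) /
                    (real ((k - t\<^sub>0) choose (t - t\<^sub>0)) * real (v choose t\<^sub>0))"
    \<comment> \<open>Users \<open>A\<close>, packets \<open>C\<close>, transmissions
      \<open>b\<close>.\<close>
    have "admits_caching_scheme TYPE('f) (card (P V)) M N (card (P V))
            (real (card (set_mset \<B>)) / real (card (P V)))"
    proof (rule triangle_free_caching_scheme)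
      show "{(A, C, b). (A, b, C) \<in> T} \<subseteq> P V \<times> P V \<times> set_mset \<B>"
        using f_P P_mono by (auto simp: T_def)
      show "triangle_free {(A, C, b). (A, b, C) \<in> T}"
        using T_free unfolding triangle_free_def by blast
      show "card {C \<in> P V. \<exists>b. (A, C, b) \<in> {(A, C, b). (A, b, C) \<in> T}} = r" if "A \<in> P V" for A
      proof -
        have "{C \<in> P V. \<exists>b. (A, C, b) \<in> {(A, C, b). (A, b, C) \<in> T}}
              = {C \<in> P V. \<exists>b. b \<in># \<B> \<and> A \<in> P b \<and> C = f b A}"
          by (simp add: T_def)
        also have "\<dots> = (\<lambda>b. f b A) ` {b \<in> set_mset \<B>. A \<in> P b}"
          using f_P P_mono by blast
        also have "{b \<in> set_mset \<B>. A \<in> P b} = {b \<in> set_mset \<B>. A \<subseteq> b}"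
          using that by (auto simp: P_def)
        finally have "{C \<in> P V. \<exists>b. (A, C, b) \<in> {(A, C, b). (A, b, C) \<in> T}}
              = (\<lambda>b. f b A) ` {b \<in> set_mset \<B>. A \<subseteq> b}" .
        \<comment> \<open>If two blocks through \<open>A\<close> gave the same partner, both would
          contain \<open>A\<close> and that partner, contradicting \<open>block_eq\<close>. So
          \<open>A\<close> lacks exactly \<open>r\<close> packets.\<close>
        moreover have "inj_on (\<lambda>b. f b A) {b \<in> set_mset \<B>. A \<subseteq> b}"
        proof (rule inj_onI, clarify)
          fix b b' assume b: "b \<in># \<B>" "A \<subseteq> b" "b' \<in># \<B>" "A \<subseteq> b'" "f b A = f b' A"
          then have "A \<in> P b" "A \<in> P b'"
            using that by (auto simp: P_def)
          then show "b = b'"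
            using block_eq[of A b' "f b A" b] b f_P[of b A] by (auto simp: T_def P_def)
        qed
        ultimately show ?thesis
          using r[OF that] by (simp add: card_image)
      qed
      show "M / real N = 1 - real r / real (card (P V))"
        using ratio r_mult[symmetric] pos cardP by simp
    qed (use finP \<open>P V \<noteq> {}\<close> sys K cardP in auto)
    then show "admits_caching_scheme TYPE('f) K M N (v choose t\<^sub>0)
          (real (v choose t) / (real (k choose t) * real (v choose t\<^sub>0)))"
      using K cardP \<beta>_real by (simp add: \<beta>_def)
  next
    fix K N :: nat and M :: real
    assume sys: "caching_system K M N" and K: "K = v choose t\<^sub>0"
      and ratio: "M / real N = 1 - real (k choose t\<^sub>0) / real (v choose t\<^sub>0)"
    \<comment> \<open>Users \<open>A\<close>, packets \<open>b\<close>, transmissions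
      \<open>C\<close>; the missing packets are the blocks through \<open>A\<close>, and
      \<open>r_\<beta>\<close> turns \<open>r / \<beta>\<close> into the stated ratio.\<close>
    have "admits_caching_scheme TYPE('f) (card (P V)) M N (card (set_mset \<B>))
            (real (card (P V)) / real (card (set_mset \<B>)))"
    proof (rule triangle_free_caching_scheme)
      show "T \<subseteq> P V \<times> set_mset \<B> \<times> P V"
        using f_P P_mono by (auto simp: T_def)
      show "card {b \<in> set_mset \<B>. \<exists>C. (A, b, C) \<in> T} = r" if "A \<in> P V" for A
      proof -
        have "{b \<in> set_mset \<B>. \<exists>C. (A, b, C) \<in> T} = {b \<in> set_mset \<B>. A \<subseteq> b}"
          using that by (auto simp: T_def P_def)
        then show ?thesis
          using r[OF that] by simp
      qed
      show "M / real N = 1 - real r / real (card (set_mset \<B>))"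
      proof -
        have "real r * real (v choose t\<^sub>0) = real \<beta> * real (k choose t\<^sub>0)"
          using r_\<beta> by (simp flip: of_nat_mult)
        then have "real (k choose t\<^sub>0) / real (v choose t\<^sub>0) = real r / real \<beta>"
          using pos \<open>0 < \<beta>\<close> by (simp add: frac_eq_eq mult.commute)
        then show ?thesis
          using ratio by (simp add: \<beta>_def)
      qed
    qed (use finP T_free \<open>0 < \<beta>\<close> sys K cardP in \<open>auto simp: \<beta>_def\<close>)
    then show "\<exists>F. real F = real (v choose t) / real (k choose t) \<and>
             admits_caching_scheme TYPE('f) K M N F
               (real (v choose t\<^sub>0) * real (k choose t) / real (v choose t))"
      using K cardP \<beta>_real by (intro exI[of _ \<beta>]) (simp add: \<beta>_def)
  next
    fix K N :: nat and M :: real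
    assume sys: "caching_system K M N" and K: "real K = real (v choose t) / real (k choose t)"
      and ratio: "M / real N = 1 - real (k choose t\<^sub>0) / real (v choose t\<^sub>0)"
    have "K = \<beta>"
      using K \<beta>_real by simp
    \<comment> \<open>Users \<open>b\<close>, packets \<open>A\<close>, transmissions
      \<open>C\<close>; a user lacks the packets in \<open>P b\<close>. Packets and transmissions
      are both indexed by \<open>P V\<close>, so the rate is 1.\<close>
    have "admits_caching_scheme TYPE('f) (card (set_mset \<B>)) M N (card (P V))
            (real (card (P V)) / real (card (P V)))"
    proof (rule triangle_free_caching_scheme)
      show "{(b, A, C). (A, b, C) \<in> T} \<subseteq> set_mset \<B> \<times> P V \<times> P V"
        using f_P P_mono by (auto simp: T_def)
      show "triangle_free {(b, A, C). (A, b, C) \<in> T}"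
        using T_free unfolding triangle_free_def by blast
      show "card {A \<in> P V. \<exists>C. (b, A, C) \<in> {(b, A, C). (A, b, C) \<in> T}} = k choose t\<^sub>0"
        if "b \<in> set_mset \<B>" for b
      proof -
        have "{A \<in> P V. \<exists>C. (b, A, C) \<in> {(b, A, C). (A, b, C) \<in> T}} = P b"
          using that P_mono by (auto simp: T_def)
        then show ?thesis
          using n_subsets[of b t\<^sub>0] blocks[OF that] by (simp add: P_def)
      qed
    qed (use finP \<open>P V \<noteq> {}\<close> sys \<open>K = \<beta>\<close> cardP ratio in \<open>auto simp: \<beta>_def\<close>)
    then show "admits_caching_scheme TYPE('f) K M N (v choose t\<^sub>0) 1"
      using \<open>K = \<beta>\<close> cardP pos by (simp add: \<beta>_def)
  qed
qed

end
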